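(* Let $X$ be a Hadamard manifold, $\Gamma\subset\mathrm{Is}(X)$ a non-elementary discrete group containing a (weak) rank one isometry $h$, $o\in\mathrm{Ax}(h)$, $\delta>0$, and $\mu$ a $\delta$-dimensional $\Gamma$-invariant conformal density normalized such that $\mu_o(\partial X)=1$. If $\sum_{\gamma\in\Gamma}e^{-\delta d(o,\gamma o)}$ converges, then $\mu_o(L_\Gamma^{\mathrm{rad}})=0$.
   Context: A Hadamard manifold $X$ is a complete simply connected Riemannian manifold of non-positive sectional curvature, with distance $d$; $\partial X$ is its geometric boundary (cone topology), $\overline X=X\cup\partial X$, $\mathrm{Is}(X)$ its isometry group; geodesics have unit speed. The limit set of a discrete $\Gamma\subset\mathrm{Is}(X)$ is $L_\Gamma=\overline{\Gamma\cdot x}\cap\partial X$; $\Gamma$ is non-elementary if $L_\Gamma$ is infinite. An isometry $h\neq\mathrm{id}$ is axial if there are $l(h)>0$ and a geodesic $\sigma$ (an axis) with $h\sigma(t)=\sigma(t+l(h))$ for all $t$; $\mathrm{Ax}(h)=\{x:d(x,hx)=l(h)\}$. A geodesic is (weak) rank one if it does not bound a flat strip of infinite width (a flat half plane); an axial isometry is (weak) rank one if it has a rank one axis. Busemann function: $\mathcal{B}_\xi(x,y)=\lim_{s\to\infty}(d(x,\sigma(s))-d(y,\sigma(s)))$ for any ray $\sigma$ in the class of $\xi\in\partial X$. A $\delta$-dimensional $\Gamma$-invariant conformal density is a continuous map $x\mapsto\mu_x$ from $X$ to the cone of positive finite Borel measures on $\partial X$ such that $\mu_o$ is supported on $L_\Gamma$,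 $\gamma_*\mu_x=\mu_{\gamma x}$ for all $\gamma\in\Gamma$, $x\in X$, and $\frac{d\mu_x}{d\mu_o}(\eta)=e^{\delta\mathcal{B}_\eta(o,x)}$ for $x\in X$, $\eta\in\mathrm{supp}(\mu_o)$. Radial limit set: let $B_x(c)$ be the open ball and $\mathrm{pr}_o(B)\subset\partial X$ the set of end points $\tau(+\infty)$ of geodesics $\tau$ starting at $o$ and passing through a point of $B$. For $c>0$ put $L_\Gamma(c)=\bigcap_{R>0}\bigcup_{\gamma\in\Gamma,\,d(o,\gamma o)>R}\mathrm{pr}_o(B_{\gamma o}(c))$, and $L_\Gamma^{\mathrm{rad}}=\bigcup_{c>0}L_\Gamma(c)$. *)

theory Defs
  imports "HOL-Analysis.Analysis" "HOL-Algebra.Group"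
begin

section \<open>Smooth functions on open subsets of coordinate space\<close>

definition partial_deriv :: "'n::finite \<Rightarrow> (real^'n \<Rightarrow> real) \<Rightarrow> real^'n \<Rightarrow> real" where
  "partial_deriv i f x = frechet_derivative f (at x) (axis i 1)"

text \<open>Meant for open \<open>S\<close> only.\<close>

primrec Ck_on :: "nat \<Rightarrow> (real^'n::finite) set \<Rightarrow> (real^'n \<Rightarrow> real) \<Rightarrow> bool" where
  "Ck_on 0 S f \<longleftrightarrow> continuous_on S f"
| "Ck_on (Suc k) S f \<longleftrightarrow> f differentiable_on S \<and> (\<forall>i. Ck_on k S (partial_deriv i f))"

definition smooth_on :: "(real^'n::finite) set \<Rightarrow> (real^'n \<Rightarrow> real) \<Rightarrow> bool" where
  "smooth_on S f \<longleftrightarrow> (\<forall>k. Ck_on k S f)"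


section \<open>Riemannian manifolds\<close>

text \<open>
  A manifold is carried by a whole type \<open>'a\<close>, whose metric is required below to be the
  Riemannian distance. A chart is a pair of a domain and a coordinate map; the coordinate map is
  irrelevant outside the domain.
\<close>

type_synonym ('a, 'n) chart = "'a set \<times> ('a \<Rightarrow> real^'n)"

definition is_chart :: "('a::topological_space, 'n::finite) chart \<Rightarrow> bool" where
  "is_chart = (\<lambda>(U, \<phi>). open U \<and> open (\<phi> ` U) \<and> homeomorphism U (\<phi> ` U) \<phi> (inv_into U \<phi>))"

definition transition ::
    "('a, 'n) chart \<Rightarrow> ('a, 'n) chart \<Rightarrow> real^'n \<Rightarrow> real^'n" where
  "transition c c' = snd c' \<circ> inv_into (fst c) (snd c)"

definition overlap :: "('a, 'n) chart \<Rightarrow> ('a, 'n) chart \<Rightarrow> (real^'n) set" where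
  "overlap c c' = snd c ` (fst c \<inter> fst c')"

definition smooth_atlas :: "('a::topological_space, 'n::finite) chart set \<Rightarrow> bool" where
  "smooth_atlas A \<longleftrightarrow>
     (\<forall>c\<in>A. is_chart c) \<and> (\<Union>c\<in>A. fst c) = UNIV \<and>
     (\<forall>c\<in>A. \<forall>c'\<in>A. \<forall>i. smooth_on (overlap c c') (\<lambda>x. transition c c' x $ i))"

text \<open>
  A metric tensor is given by its coefficient matrices: \<open>G c x\<close> is the Gram matrix of the
  coordinate fields of the chart \<open>c\<close>, at the point with coordinates \<open>x\<close>.
\<close>

type_synonym ('a, 'n) metric_tensor = "('a, 'n) chart \<Rightarrow> real^'n \<Rightarrow> real^'n^'n"

definition riemannian_metric ::
    "('a::topological_space, 'n::finite) chart set \<Rightarrow> ('a, 'n) metric_tensor \<Rightarrow> bool" where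
  "riemannian_metric A G \<longleftrightarrow>
     (\<forall>c\<in>A. (\<forall>i j. smooth_on (snd c ` fst c) (\<lambda>x. G c x $ i $ j)) \<and>
       (\<forall>x \<in> snd c ` fst c. transpose (G c x) = G c x \<and> (\<forall>v. v \<noteq> 0 \<longrightarrow> v \<bullet> (G c x *v v) > 0))) \<and>
     (\<forall>c\<in>A. \<forall>c'\<in>A. \<forall>x \<in> overlap c c'.
       let J = matrix (frechet_derivative (transition c c') (at x))
       in G c x = transpose J ** G c' (transition c c' x) ** J)"

text \<open>
  By compactness of the unit interval, the condition below says that the curve is continuous and
  continuously differentiable off finitely many points. Its derivative may be unbounded near such
  points, so the length is a possibly infinite Lebesgue integral; the infimum of the lengths is
  not affected.
\<close>

definition piecewise_C1_curve ::
    "('a::topological_space, 'n::finite) chart set \<Rightarrow> (real \<Rightarrow> 'a) \<Rightarrow> bool" where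
  "piecewise_C1_curve A \<gamma> \<longleftrightarrow> path \<gamma> \<and>
     (\<forall>(U, \<phi>)\<in>A. \<forall>a b. 0 \<le> a \<and> a < b \<and> b \<le> 1 \<and> \<gamma> ` {a..b} \<subseteq> U \<longrightarrow>
        (\<phi> \<circ> \<gamma>) piecewise_C1_differentiable_on {a..b})"

text \<open>The speed does not depend on the chart, by the transformation rule for \<open>G\<close>.\<close>

definition speed ::
    "('a, 'n::finite) chart set \<Rightarrow> ('a, 'n) metric_tensor \<Rightarrow> (real \<Rightarrow> 'a) \<Rightarrow> real \<Rightarrow> real" where
  "speed A G \<gamma> t =
     (let c = (SOME c. c \<in> A \<and> \<gamma> t \<in> fst c);
          v = vector_derivative (snd c \<circ> \<gamma>) (at t)
      in sqrt (v \<bullet> (G c (snd c (\<gamma> t)) *v v)))"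

definition curve_length ::
    "('a, 'n::finite) chart set \<Rightarrow> ('a, 'n) metric_tensor \<Rightarrow> (real \<Rightarrow> 'a) \<Rightarrow> ennreal" where
  "curve_length A G \<gamma> = (\<integral>\<^sup>+ t \<in> {0..1}. ennreal (speed A G \<gamma> t) \<partial>lborel)"

definition riemannian_distance ::
    "('a::topological_space, 'n::finite) chart set \<Rightarrow> ('a, 'n) metric_tensor \<Rightarrow> 'a \<Rightarrow> 'a \<Rightarrow> ennreal" where
  "riemannian_distance A G x y =
     (INF \<gamma> \<in> {\<gamma>. piecewise_C1_curve A \<gamma> \<and> pathstart \<gamma> = x \<and> pathfinish \<gamma> = y}. curve_length A G \<gamma>)"

text \<open>
  Curvature of a field \<open>g\<close> of coefficient matrices. With the Levi-Civita connection,
  \<open>christoffel g k i j\<close> is the \<open>k\<close>-th component of the derivative of the \<open>j\<close>-th coordinate field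
  along the \<open>i\<close>-th one, and \<open>curvature g l i j k\<close> is the \<open>l\<close>-th component of
  \<open>R(e\<^sub>i, e\<^sub>j) e\<^sub>k\<close>, with the sign convention \<open>R(X,Y) = [D\<^sub>X, D\<^sub>Y] - D\<^bsub>[X,Y]\<^esub>\<close>
  (round spheres have positive sectional curvature).
\<close>

definition christoffel ::
    "(real^'n \<Rightarrow> real^'n^'n) \<Rightarrow> 'n::finite \<Rightarrow> 'n \<Rightarrow> 'n \<Rightarrow> real^'n \<Rightarrow> real" where
  "christoffel g k i j x =
     (\<Sum>l\<in>UNIV. matrix_inv (g x) $ k $ l *
        (partial_deriv i (\<lambda>y. g y $ j $ l) x + partial_deriv j (\<lambda>y. g y $ i $ l) x
          - partial_deriv l (\<lambda>y. g y $ i $ j) x)) / 2"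

definition curvature ::
    "(real^'n \<Rightarrow> real^'n^'n) \<Rightarrow> 'n::finite \<Rightarrow> 'n \<Rightarrow> 'n \<Rightarrow> 'n \<Rightarrow> real^'n \<Rightarrow> real" where
  "curvature g l i j k x =
     partial_deriv i (christoffel g l j k) x - partial_deriv j (christoffel g l i k) x
     + (\<Sum>m\<in>UNIV. christoffel g l i m x * christoffel g m j k x
                  - christoffel g l j m x * christoffel g m i k x)"

definition sectional_curvature ::
    "(real^'n \<Rightarrow> real^'n^'n) \<Rightarrow> real^'n \<Rightarrow> real^'n \<Rightarrow> real^'n::finite \<Rightarrow> real" where
  "sectional_curvature g x u v =
     (let Ruvv = (\<chi> l. \<Sum>i\<in>UNIV. \<Sum>j\<in>UNIV. \<Sum>k\<in>UNIV. curvature g l i j k x * u $ i * v $ j * v $ k);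
          ip = (\<lambda>a b. a \<bullet> (g x *v b))
      in ip Ruvv u / (ip u u * ip v v - (ip u v)\<^sup>2))"

locale riemannian_manifold =
  fixes A :: "('a::{metric_space, second_countable_topology}, 'n::finite) chart set"
    and G :: "('a, 'n) metric_tensor"
  assumes smooth_atlas: "smooth_atlas A"
    and riemannian_metric: "riemannian_metric A G"
    and dist_eq: "riemannian_distance A G x y = ennreal (dist x y)"

locale hadamard_manifold = riemannian_manifold A G
  for A :: "('a::{metric_space, second_countable_topology}, 'n::finite) chart set"
    and G :: "('a, 'n) metric_tensor" +
  assumes complete_UNIV: "complete (UNIV :: 'a set)"
    and simply_connected_UNIV: "simply_connected (UNIV :: 'a set)"
    and nonpositive_curvature:
      "\<lbrakk>c \<in> A; x \<in> snd c ` fst c; u \<noteq> v; independent {u, v}\<rbrakk>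
        \<Longrightarrow> sectional_curvature (G c) x u v \<le> 0"


section \<open>Geodesics and the geometric boundary\<close>

definition geodesic_segment :: "(real \<Rightarrow> 'a::metric_space) \<Rightarrow> 'a \<Rightarrow> 'a \<Rightarrow> bool" where
  "geodesic_segment \<sigma> x y \<longleftrightarrow> \<sigma> 0 = x \<and> \<sigma> (dist x y) = y \<and>
     (\<forall>s\<in>{0..dist x y}. \<forall>t\<in>{0..dist x y}. dist (\<sigma> s) (\<sigma> t) = \<bar>s - t\<bar>)"

definition geodesic_ray :: "(real \<Rightarrow> 'a::metric_space) \<Rightarrow> bool" where
  "geodesic_ray \<sigma> \<longleftrightarrow> (\<forall>s\<ge>0. \<forall>t\<ge>0. dist (\<sigma> s) (\<sigma> t) = \<bar>s - t\<bar>)"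

definition geodesic :: "(real \<Rightarrow> 'a::metric_space) \<Rightarrow> bool" where
  "geodesic \<sigma> \<longleftrightarrow> (\<forall>s t. dist (\<sigma> s) (\<sigma> t) = \<bar>s - t\<bar>)"

text \<open>
  Rays are functions on the whole real line whose values at negative arguments are irrelevant;
  rays that agree for nonnegative arguments are asymptotic, hence represent the same boundary point.
\<close>

definition asymptotic :: "((real \<Rightarrow> 'a::metric_space) \<times> (real \<Rightarrow> 'a)) set" where
  "asymptotic = {(\<sigma>, \<tau>). geodesic_ray \<sigma> \<and> geodesic_ray \<tau> \<and> (\<exists>C. \<forall>t\<ge>0. dist (\<sigma> t) (\<tau> t) \<le> C)}"

definition geometric_boundary :: "(real \<Rightarrow> 'a::metric_space) set set" where
  "geometric_boundary = Collect geodesic_ray // asymptotic"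

text \<open>
  Interior points of the compactification are tagged by \<open>Inl\<close>, boundary points by \<open>Inr\<close>.
  The neighbourhood below consists of the points different from \<open>\<sigma> 0\<close> whose segment or ray from
  \<open>\<sigma> 0\<close> has length \<open>> R\<close> and is \<open>\<epsilon>\<close>-close to \<open>\<sigma>\<close> at time \<open>R\<close>. The cone topology is the same for
  all base points \<open>p\<close>.
\<close>

definition cone_nbhd ::
    "(real \<Rightarrow> 'a::metric_space) \<Rightarrow> real \<Rightarrow> real \<Rightarrow> ('a + (real \<Rightarrow> 'a) set) set" where
  "cone_nbhd \<sigma> R \<epsilon> =
     Inl ` {y. dist (\<sigma> 0) y > R \<and> (\<exists>\<tau>. geodesic_segment \<tau> (\<sigma> 0) y \<and> dist (\<tau> R) (\<sigma> R) < \<epsilon>)} \<union>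
     Inr ` {\<xi> \<in> geometric_boundary. \<exists>\<tau>\<in>\<xi>. \<tau> 0 = \<sigma> 0 \<and> dist (\<tau> R) (\<sigma> R) < \<epsilon>}"

definition cone_topology :: "'a::metric_space \<Rightarrow> ('a + (real \<Rightarrow> 'a) set) topology" where
  "cone_topology p = topology_generated_by
     ({Inl ` U | U. open U} \<union>
      {cone_nbhd \<sigma> R \<epsilon> | \<sigma> R \<epsilon>. geodesic_ray \<sigma> \<and> \<sigma> 0 = p \<and> R > 0 \<and> \<epsilon> > 0})"

definition boundary_topology :: "'a::metric_space \<Rightarrow> (real \<Rightarrow> 'a) set topology" where
  "boundary_topology p =
     pullback_topology geometric_boundary Inr (cone_topology p)"

text \<open>
  \<open>has_busemann_value \<xi> x y b\<close> says that the Busemann function of \<open>\<xi>\<close> at \<open>(x, y)\<close> has the value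
  \<open>b\<close>, whichever ray in the class \<open>\<xi>\<close> is used to compute it.
\<close>

definition has_busemann_value ::
    "(real \<Rightarrow> 'a::metric_space) set \<Rightarrow> 'a \<Rightarrow> 'a \<Rightarrow> real \<Rightarrow> bool" where
  "has_busemann_value \<xi> x y b \<longleftrightarrow>
     (\<forall>\<sigma>\<in>\<xi>. ((\<lambda>s. dist x (\<sigma> s) - dist y (\<sigma> s)) \<longlongrightarrow> b) at_top)"


section \<open>Isometries\<close>

definition is_isometry :: "('a::metric_space \<Rightarrow> 'a) \<Rightarrow> bool" where
  "is_isometry f \<longleftrightarrow> bij f \<and> (\<forall>x y. dist (f x) (f y) = dist x y)"

definition isometry_group :: "('a::metric_space \<Rightarrow> 'a) monoid" where
  "isometry_group = \<lparr>carrier = Collect is_isometry, mult = (\<circ>), one = id\<rparr>"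

text \<open>The compact-open topology on the isometry group.\<close>

definition isometry_topology :: "('a::metric_space \<Rightarrow> 'a) topology" where
  "isometry_topology = topology_generated_by
     {{f. is_isometry f \<and> f ` K \<subseteq> U} | K U. compact K \<and> open U}"

definition discrete_isometry_group :: "('a::metric_space \<Rightarrow> 'a) set \<Rightarrow> bool" where
  "discrete_isometry_group \<Gamma> \<longleftrightarrow> subgroup \<Gamma> isometry_group \<and>
     subtopology isometry_topology \<Gamma> = discrete_topology \<Gamma>"

definition boundary_action :: "('a \<Rightarrow> 'a) \<Rightarrow> (real \<Rightarrow> 'a) set \<Rightarrow> (real \<Rightarrow> 'a) set" where
  "boundary_action f \<xi> = (\<lambda>\<sigma>. f \<circ> \<sigma>) ` \<xi>"

text \<open>The limit set does not depend on the base point \<open>p\<close>.\<close>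

definition limit_set :: "'a::metric_space \<Rightarrow> ('a \<Rightarrow> 'a) set \<Rightarrow> (real \<Rightarrow> 'a) set set" where
  "limit_set p \<Gamma> = {\<xi> \<in> geometric_boundary.
     Inr \<xi> \<in> cone_topology p closure_of ((\<lambda>f. Inl (f p)) ` \<Gamma>)}"

definition non_elementary :: "'a::metric_space \<Rightarrow> ('a \<Rightarrow> 'a) set \<Rightarrow> bool" where
  "non_elementary p \<Gamma> \<longleftrightarrow> infinite (limit_set p \<Gamma>)"

definition is_axis :: "('a::metric_space \<Rightarrow> 'a) \<Rightarrow> real \<Rightarrow> (real \<Rightarrow> 'a) \<Rightarrow> bool" where
  "is_axis h l \<sigma> \<longleftrightarrow> l > 0 \<and> geodesic \<sigma> \<and> (\<forall>t. h (\<sigma> t) = \<sigma> (t + l))"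

definition axial :: "('a::metric_space \<Rightarrow> 'a) \<Rightarrow> bool" where
  "axial h \<longleftrightarrow> is_isometry h \<and> h \<noteq> id \<and> (\<exists>l \<sigma>. is_axis h l \<sigma>)"

definition translation_length :: "('a::metric_space \<Rightarrow> 'a) \<Rightarrow> real" where
  "translation_length h = (THE l. \<exists>\<sigma>. is_axis h l \<sigma>)"

definition axis_set :: "('a::metric_space \<Rightarrow> 'a) \<Rightarrow> 'a set" where
  "axis_set h = {x. dist x (h x) = translation_length h}"

text \<open>The product metric on \<open>real \<times> real\<close> is the Euclidean one.\<close>

definition bounds_flat_half_plane :: "(real \<Rightarrow> 'a::metric_space) \<Rightarrow> bool" where
  "bounds_flat_half_plane \<sigma> \<longleftrightarrow> (\<exists>F :: real \<times> real \<Rightarrow> 'a.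
     (\<forall>u \<in> UNIV \<times> {0..}. \<forall>v \<in> UNIV \<times> {0..}. dist (F u) (F v) = dist u v) \<and>
     (\<forall>t. F (t, 0) = \<sigma> t))"

definition rank_one_geodesic :: "(real \<Rightarrow> 'a::metric_space) \<Rightarrow> bool" where
  "rank_one_geodesic \<sigma> \<longleftrightarrow> geodesic \<sigma> \<and> \<not> bounds_flat_half_plane \<sigma>"

definition rank_one_isometry :: "('a::metric_space \<Rightarrow> 'a) \<Rightarrow> bool" where
  "rank_one_isometry h \<longleftrightarrow> axial h \<and> (\<exists>l \<sigma>. is_axis h l \<sigma> \<and> rank_one_geodesic \<sigma>)"


section \<open>Conformal densities and the radial limit set\<close>

definition boundary_borel :: "'a::metric_space \<Rightarrow> (real \<Rightarrow> 'a) set measure" where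
  "boundary_borel p = sigma geometric_boundary {U. openin (boundary_topology p) U}"

definition boundary_support ::
    "'a::metric_space \<Rightarrow> (real \<Rightarrow> 'a) set measure \<Rightarrow> (real \<Rightarrow> 'a) set set" where
  "boundary_support p M = {\<eta> \<in> geometric_boundary.
     \<forall>U. openin (boundary_topology p) U \<and> \<eta> \<in> U \<longrightarrow> emeasure M U > 0}"

text \<open>
  Continuity of \<open>\<mu>\<close> refers to the weak topology on measures. The point \<open>p\<close> is the reference point
  of the density and the base point of the cone topology.
\<close>

definition conformal_density ::
    "'a::metric_space \<Rightarrow> ('a \<Rightarrow> 'a) set \<Rightarrow> real \<Rightarrow> ('a \<Rightarrow> (real \<Rightarrow> 'a) set measure) \<Rightarrow> bool" where
  "conformal_density p \<Gamma> \<delta> \<mu> \<longleftrightarrow>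
     (\<forall>x. finite_measure (\<mu> x) \<and> space (\<mu> x) = geometric_boundary \<and>
          sets (\<mu> x) = sets (boundary_borel p)) \<and>
     (\<forall>f. continuous_map (boundary_topology p) euclideanreal f \<longrightarrow>
          continuous_on UNIV (\<lambda>x. \<integral>\<eta>. f \<eta> \<partial>\<mu> x)) \<and>
     boundary_support p (\<mu> p) \<subseteq> limit_set p \<Gamma> \<and>
     (\<forall>\<gamma>\<in>\<Gamma>. \<forall>x. distr (\<mu> x) (boundary_borel p) (boundary_action \<gamma>) = \<mu> (\<gamma> x)) \<and>
     (\<forall>x. \<exists>g \<in> borel_measurable (\<mu> p). \<mu> x = density (\<mu> p) g \<and>
          (\<forall>\<eta> \<in> boundary_support p (\<mu> p). \<exists>b. has_busemann_value \<eta> p x b \<and>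
             g \<eta> = ennreal (exp (\<delta> * b))))"

text \<open>
  A boundary point is a class of rays, so \<open>\<tau> \<in> \<xi>\<close> says that \<open>\<xi>\<close> is the end point of the ray \<open>\<tau>\<close>.
\<close>

definition shadow :: "'a::metric_space \<Rightarrow> 'a set \<Rightarrow> (real \<Rightarrow> 'a) set set" where
  "shadow p B = {\<xi> \<in> geometric_boundary. \<exists>\<tau>\<in>\<xi>. \<tau> 0 = p \<and> (\<exists>t\<ge>0. \<tau> t \<in> B)}"

definition radial_limit_set_const ::
    "'a::metric_space \<Rightarrow> ('a \<Rightarrow> 'a) set \<Rightarrow> real \<Rightarrow> (real \<Rightarrow> 'a) set set" where
  "radial_limit_set_const p \<Gamma> c =
     (\<Inter>R\<in>{0<..}. \<Union>\<gamma>\<in>{\<gamma>\<in>\<Gamma>. dist p (\<gamma> p) > R}. shadow p (ball (\<gamma> p) c))"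

definition radial_limit_set :: "'a::metric_space \<Rightarrow> ('a \<Rightarrow> 'a) set \<Rightarrow> (real \<Rightarrow> 'a) set set" where
  "radial_limit_set p \<Gamma> = (\<Union>c\<in>{0<..}. radial_limit_set_const p \<Gamma> c)"

end

theory Submission
  imports Defs
begin

text \<open>
  The proof is the convergence half of the Borel--Cantelli lemma, applied to the shadows of the
  balls of radius \<open>c\<close> about the orbit points. A point lies in \<open>L\<^sub>\<Gamma>(c)\<close> only if it lies in infinitely
  many of these shadows, so it suffices that their measures are summable, and this follows from the
  upper half of Sullivan's shadow lemma,

    \<open>\<mu>\<^sub>p (shadow p (ball (\<gamma> p) c)) \<le> e\<^bsup>2 \<delta> c\<^esup> e\<^bsup>- \<delta> d(p, \<gamma> p)\<^esup>\<close>.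

  To see the bound, let \<open>\<tau>\<close> be a ray from \<open>p\<close> that passes within \<open>c\<close> of \<open>\<gamma> p\<close>. The detour through
  \<open>\<gamma> p\<close> costs at most \<open>2 c\<close>, so the Busemann function of its end point is at least
  \<open>d(p, \<gamma> p) - 2 c\<close> at \<open>(p, \<gamma> p)\<close>. Hence the density of \<open>\<mu>\<^bsub>\<gamma> p\<^esub>\<close> with respect to \<open>\<mu>\<^sub>p\<close> is at least
  \<open>e\<^bsup>\<delta> (d(p, \<gamma> p) - 2 c)\<^esup>\<close> on the shadow, whereas the total mass of \<open>\<mu>\<^bsub>\<gamma> p\<^esub> = \<gamma>\<^sub>* \<mu>\<^sub>p\<close> is at most that
  of \<open>\<mu>\<^sub>p\<close>.

  Two topological facts are behind this. The Busemann function controls the density only on the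
  support of \<open>\<mu>\<^sub>p\<close>, which has full measure because the boundary is second countable
  (\<open>second_countable_boundary_topology\<close>, \<open>AE_boundary_support\<close>). Shadows of open sets are open
  (\<open>openin_shadow\<close>), so that the radial limit set is Borel. Both facts follow from the definition of
  the cone topology by the triangle inequality, without comparison geometry, because the shadows
  and the basic neighbourhoods are described by rays with the same origin \<open>p\<close>.
\<close>

section \<open>Second countability of the boundary\<close>

definition rays_end_through :: "'a::metric_space \<Rightarrow> real \<Rightarrow> 'a set \<Rightarrow> (real \<Rightarrow> 'a) set set" where
  "rays_end_through p r V = {\<xi> \<in> geometric_boundary. \<exists>\<tau>\<in>\<xi>. \<tau> 0 = p \<and> \<tau> r \<in> V}"

lemma boundary_point_geodesic_ray:
  assumes "\<xi> \<in> geometric_boundary" "\<tau> \<in> \<xi>"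
  shows "geodesic_ray \<tau>"
  using assms by (auto simp: geometric_boundary_def asymptotic_def quotient_def)

lemma openin_boundary_subset:
  "openin (boundary_topology p) U \<Longrightarrow> U \<subseteq> geometric_boundary"
  by (auto simp: boundary_topology_def openin_pullback_topology)

lemma vimage_cone_nbhd:
  "Inr -` cone_nbhd \<sigma> R \<epsilon> = rays_end_through (\<sigma> 0) R (ball (\<sigma> R) \<epsilon>)"
  by (auto simp: cone_nbhd_def rays_end_through_def dist_commute image_iff)

lemma openin_rays_end_through:
  assumes "open V" "r > 0"
  shows "openin (boundary_topology p) (rays_end_through p r V)"
proof (subst openin_subopen, intro ballI)
  fix \<xi> assume \<xi>: "\<xi> \<in> rays_end_through p r V"
  then obtain \<tau> where \<tau>: "\<xi> \<in> geometric_boundary" "\<tau> \<in> \<xi>" "\<tau> 0 = p" "\<tau> r \<in> V"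
    by (auto simp: rays_end_through_def)
  obtain e where e: "e > 0" "ball (\<tau> r) e \<subseteq> V"
    using assms(1) \<tau>(4) by (auto simp: open_contains_ball)
  have "openin (cone_topology p) (cone_nbhd \<tau> r e)"
    unfolding cone_topology_def
    using boundary_point_geodesic_ray[OF \<tau>(1,2)] \<tau>(3) assms(2) e(1)
    by (intro topology_generated_by_Basis) auto
  then have "openin (boundary_topology p) (Inr -` cone_nbhd \<tau> r e \<inter> geometric_boundary)"
    by (auto simp: boundary_topology_def openin_pullback_topology)
  moreover have "Inr -` cone_nbhd \<tau> r e \<inter> geometric_boundary = rays_end_through p r (ball (\<tau> r) e)"
    unfolding vimage_cone_nbhd \<tau>(3) by (auto simp: rays_end_through_def)
  moreover have "\<xi> \<in> rays_end_through p r (ball (\<tau> r) e)"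
    using \<tau> e(1) by (auto simp: rays_end_through_def)
  moreover have "rays_end_through p r (ball (\<tau> r) e) \<subseteq> rays_end_through p r V"
    using e(2) by (auto simp: rays_end_through_def)
  ultimately show "\<exists>T. openin (boundary_topology p) T \<and> \<xi> \<in> T \<and> T \<subseteq> rays_end_through p r V"
    by auto
qed

text \<open>
  Since rays have unit speed, the time at which a ray is tested can be moved a little, at the
  expense of the radius of the ball. Hence rational times suffice.
\<close>

lemma rays_end_through_rational_time:
  fixes p :: "'a::metric_space"
  assumes B: "topological_basis B"
    and "r > 0" "\<xi> \<in> rays_end_through p r (ball x \<epsilon>)"
  obtains q V where "q \<in> \<rat>" "q > 0" "V \<in> B" "\<xi> \<in> rays_end_through p q V"
    "rays_end_through p q V \<subseteq> rays_end_through p r (ball x \<epsilon>)"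
proof -
  obtain \<tau> where \<tau>: "\<xi> \<in> geometric_boundary" "\<tau> \<in> \<xi>" "\<tau> 0 = p" "dist x (\<tau> r) < \<epsilon>"
    using assms(3) by (auto simp: rays_end_through_def)
  define e where "e = (\<epsilon> - dist x (\<tau> r)) / 2"
  have "e > 0" using \<tau>(4) by (simp add: e_def)
  then obtain q where q: "q \<in> \<rat>" "r < q" "q < r + e"
    using Rats_dense_in_real[of r "r + e"] by auto
  have shift: "dist (\<rho> r) (\<rho> q) < e" if "\<rho> \<in> \<xi>'" "\<xi>' \<in> geometric_boundary" for \<rho> and \<xi>' :: "(real \<Rightarrow> 'a) set"
    using boundary_point_geodesic_ray[OF that(2,1)] q \<open>r > 0\<close> by (simp add: geodesic_ray_def)
  have "dist x (\<tau> q) < \<epsilon> - e"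
    using shift[OF \<tau>(2,1)] dist_triangle[of x "\<tau> q" "\<tau> r"] unfolding e_def by argo
  then obtain V where V: "V \<in> B" "\<tau> q \<in> V" "V \<subseteq> ball x (\<epsilon> - e)"
    using topological_basisE[OF B open_ball, of "\<tau> q" x "\<epsilon> - e"] by auto
  have "rays_end_through p q V \<subseteq> rays_end_through p r (ball x \<epsilon>)"
  proof
    fix \<xi>' assume "\<xi>' \<in> rays_end_through p q V"
    then obtain \<rho> where \<rho>: "\<xi>' \<in> geometric_boundary" "\<rho> \<in> \<xi>'" "\<rho> 0 = p" "\<rho> q \<in> V"
      by (auto simp: rays_end_through_def)
    have "dist x (\<rho> q) < \<epsilon> - e" using V(3) \<rho>(4) by auto
    then have "dist x (\<rho> r) < \<epsilon>"
      using shift[OF \<rho>(2,1)] dist_triangle[of x "\<rho> r" "\<rho> q"] dist_commute[of "\<rho> q" "\<rho> r"] by argo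
    then show "\<xi>' \<in> rays_end_through p r (ball x \<epsilon>)"
      using \<rho> by (auto simp: rays_end_through_def)
  qed
  moreover have "\<xi> \<in> rays_end_through p q V"
    using \<tau> V by (auto simp: rays_end_through_def)
  ultimately show thesis using that q V(1) \<open>r > 0\<close> by force
qed

text \<open>
  The sets of end points of rays that are in a basic open set at a rational time form a countable
  subbase.
\<close>

lemma second_countable_boundary_topology:
  fixes p :: "'a::{metric_space, second_countable_topology}"
  shows "second_countable (boundary_topology p)"
proof -
  obtain B :: "'a set set" where B: "countable B" "topological_basis B"
    using ex_countable_basis by blast
  define S where "S = (\<lambda>(q, V). rays_end_through p q V) ` ((\<rat> \<inter> {0<..}) \<times> B)"
  \<comment> \<open>The empty intersection is excluded: it would be the set of all sets of rays.\<close>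
  define C where "C = Inter ` {F. finite F \<and> F \<subseteq> S \<and> F \<noteq> {}}"
  have "countable S"
    unfolding S_def using B(1) countable_rat by (intro countable_image countable_SIGMA) auto
  then have "countable {F. finite F \<and> F \<subseteq> S}"
    by (rule countable_Collect_finite_subset)
  then have "countable {F. finite F \<and> F \<subseteq> S \<and> F \<noteq> {}}"
    by (rule countable_subset[rotated]) auto
  then have count: "countable C"
    unfolding C_def by (rule countable_image)
  have "openin (boundary_topology p) V" if "V \<in> S" for V
    using that topological_basis_open[OF B(2)] by (auto simp: S_def intro!: openin_rays_end_through)
  then have op: "openin (boundary_topology p) V" if "V \<in> C" for V
    using that by (auto simp: C_def intro!: openin_Inter)
  have C_Int: "V \<inter> V' \<in> C" if "V \<in> C" "V' \<in> C" for V V'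
  proof -
    obtain F F' where F: "V = \<Inter>F" "finite F" "F \<subseteq> S" "F \<noteq> {}"
      and F': "V' = \<Inter>F'" "finite F'" "F' \<subseteq> S" "F' \<noteq> {}"
      using \<open>V \<in> C\<close> \<open>V' \<in> C\<close> unfolding C_def by blast
    have "V \<inter> V' = \<Inter>(F \<union> F')" using F F' by auto
    moreover have "\<dots> \<in> C"
      unfolding C_def using F F' by (intro imageI) auto
    ultimately show ?thesis by simp
  qed
  have base: "\<exists>V\<in>C. \<xi> \<in> V \<and> V \<subseteq> Inr -` W"
    if "generate_topology_on ({Inl ` U | U. open U} \<union>
        {cone_nbhd \<sigma> R \<epsilon> | \<sigma> R \<epsilon>. geodesic_ray \<sigma> \<and> \<sigma> 0 = p \<and> R > 0 \<and> \<epsilon> > 0}) W"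
      and "\<xi> \<in> geometric_boundary" "Inr \<xi> \<in> W" for W \<xi>
    using that
  proof (induction arbitrary: \<xi>)
    case Empty
    then show ?case by simp
  next
    case (Int a b)
    obtain V where V: "V \<in> C" "\<xi> \<in> V" "V \<subseteq> Inr -` a"
      using Int.IH(1)[of \<xi>] Int.prems by auto
    obtain V' where V': "V' \<in> C" "\<xi> \<in> V'" "V' \<subseteq> Inr -` b"
      using Int.IH(2)[of \<xi>] Int.prems by auto
    have "V \<inter> V' \<in> C"
      using V(1) V'(1) by (rule C_Int)
    moreover have "\<xi> \<in> V \<inter> V'" "V \<inter> V' \<subseteq> Inr -` (a \<inter> b)"
      using V V' by auto
    ultimately show ?case by blast
  next
    case (UN K)
    then show ?case by (meson UnionE Union_upper order_trans vimage_mono)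
  next
    case (Basis s)
    then obtain \<sigma> R \<epsilon> where s: "s = cone_nbhd \<sigma> R \<epsilon>" "\<sigma> 0 = p" "R > 0"
      by auto
    have "\<xi> \<in> Inr -` s"
      using Basis.prems by simp
    then have "\<xi> \<in> rays_end_through p R (ball (\<sigma> R) \<epsilon>)"
      unfolding s(1) vimage_cone_nbhd s(2) .
    from rays_end_through_rational_time[OF B(2) s(3) this]
    obtain q V where "q \<in> \<rat>" "q > 0" "V \<in> B" "\<xi> \<in> rays_end_through p q V"
      "rays_end_through p q V \<subseteq> Inr -` s"
      using s by (metis vimage_cone_nbhd)
    moreover from this have "\<Inter>{rays_end_through p q V} \<in> C"
      unfolding C_def by (intro imageI) (auto simp: S_def)
    ultimately show ?case by auto
  qed
  have "\<exists>V\<in>C. \<xi> \<in> V \<and> V \<subseteq> U" if U: "openin (boundary_topology p) U" "\<xi> \<in> U" for U \<xi>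
  proof -
    obtain W where W: "openin (cone_topology p) W" "U = Inr -` W \<inter> geometric_boundary"
      using U(1) by (auto simp: boundary_topology_def openin_pullback_topology)
    obtain V where "V \<in> C" "\<xi> \<in> V" "V \<subseteq> Inr -` W"
      using base[of W \<xi>] W U(2)
      unfolding cone_topology_def openin_topology_generated_by_iff by blast
    then show ?thesis using W(2) openin_boundary_subset[OF op] by blast
  qed
  then show ?thesis
    unfolding second_countable_def using count op by blast
qed

section \<open>Measurability and the support\<close>

lemma shadow_mono: "V \<subseteq> W \<Longrightarrow> shadow p V \<subseteq> shadow p W"
  unfolding shadow_def by blast

lemma openin_shadow:
  assumes "open V"
  shows "openin (boundary_topology p) (shadow p V)"
proof -
  have "shadow p V = (\<Union>t\<in>{0<..}. rays_end_through p t V)" (is "_ = ?U")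
  proof
    show "shadow p V \<subseteq> ?U"
    proof
      fix \<xi> assume "\<xi> \<in> shadow p V"
      then obtain \<tau> t where \<tau>: "\<xi> \<in> geometric_boundary" "\<tau> \<in> \<xi>" "\<tau> 0 = p" "t \<ge> 0" "\<tau> t \<in> V"
        by (auto simp: shadow_def)
      obtain e where e: "e > 0" "ball (\<tau> t) e \<subseteq> V"
        using assms \<tau>(5) by (auto simp: open_contains_ball)
      \<comment> \<open>A slightly later time serves as well; it is positive even if the origin lies in \<open>V\<close>.\<close>
      have "dist (\<tau> t) (\<tau> (t + e / 2)) = e / 2"
        using boundary_point_geodesic_ray[OF \<tau>(1,2)] \<tau>(4) e(1) by (simp add: geodesic_ray_def)
      then have "\<tau> (t + e / 2) \<in> V" using e by auto
      then show "\<xi> \<in> ?U"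
        using \<tau> e(1) by (intro UN_I[of "t + e / 2"]) (auto simp: rays_end_through_def)
    qed
    show "?U \<subseteq> shadow p V"
    proof
      fix \<xi> assume "\<xi> \<in> ?U"
      then obtain t \<tau> where "\<xi> \<in> geometric_boundary" "\<tau> \<in> \<xi>" "\<tau> 0 = p" "t > 0" "\<tau> t \<in> V"
        by (auto simp: rays_end_through_def)
      then show "\<xi> \<in> shadow p V"
        unfolding shadow_def using less_imp_le by blast
    qed
  qed
  then show ?thesis
    using assms by (auto intro!: openin_rays_end_through)
qed

lemma sets_boundary_borel_openin:
  "openin (boundary_topology p) U \<Longrightarrow> U \<in> sets (boundary_borel p)"
  unfolding boundary_borel_def using openin_boundary_subset[of p]
  by (subst sets_measure_of) auto

text \<open>
  By monotonicity in \<open>R\<close> and in \<open>c\<close>, integral values of both suffice; this leaves a countable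
  intersection and a countable union.
\<close>

lemma radial_limit_set_const_nat:
  "radial_limit_set_const p \<Gamma> c =
     (\<Inter>n\<in>{0<..}. \<Union>\<gamma>\<in>{\<gamma>\<in>\<Gamma>. dist p (\<gamma> p) > real n}. shadow p (ball (\<gamma> p) c))" (is "_ = ?I")
proof
  show "radial_limit_set_const p \<Gamma> c \<subseteq> ?I"
    unfolding radial_limit_set_const_def by fastforce
  show "?I \<subseteq> radial_limit_set_const p \<Gamma> c"
    unfolding radial_limit_set_const_def
  proof (intro subsetI INT_I)
    fix \<xi> and R :: real assume \<xi>: "\<xi> \<in> ?I" and "R \<in> {0<..}"
    then obtain n where n: "R < real n" "n > 0"
      using reals_Archimedean2[of R] by force
    with \<xi> obtain \<gamma> where "\<gamma> \<in> \<Gamma>" "dist p (\<gamma> p) > real n" "\<xi> \<in> shadow p (ball (\<gamma> p) c)"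
      by auto
    then show "\<xi> \<in> (\<Union>\<gamma>\<in>{\<gamma>\<in>\<Gamma>. dist p (\<gamma> p) > R}. shadow p (ball (\<gamma> p) c))"
      using n by force
  qed
qed

lemma radial_limit_set_nat:
  "radial_limit_set p \<Gamma> = (\<Union>n\<in>{0<..}. radial_limit_set_const p \<Gamma> (real n))" (is "_ = ?U")
proof
  have mono: "radial_limit_set_const p \<Gamma> c \<subseteq> radial_limit_set_const p \<Gamma> c'" if "c \<le> c'" for c c'
    unfolding radial_limit_set_const_def
    using that by (intro INT_anti_mono UN_mono order_refl shadow_mono subset_ball)
  show "radial_limit_set p \<Gamma> \<subseteq> ?U"
    unfolding radial_limit_set_def
  proof (rule UN_least)
    fix c :: real assume "c \<in> {0<..}"
    then obtain n where "c < real n" "n > 0"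
      using reals_Archimedean2[of c] by force
    then show "radial_limit_set_const p \<Gamma> c \<subseteq> ?U" using mono[of c "real n"] by auto
  qed
  show "?U \<subseteq> radial_limit_set p \<Gamma>"
    unfolding radial_limit_set_def by force
qed

lemma sets_radial_limit_set_const:
  "radial_limit_set_const p \<Gamma> c \<in> sets (boundary_borel p)"
proof -
  have "(\<Union>\<gamma>\<in>{\<gamma>\<in>\<Gamma>. dist p (\<gamma> p) > real n}. shadow p (ball (\<gamma> p) c)) \<in> sets (boundary_borel p)"
    for n
    using openin_shadow[OF open_ball] by (intro sets_boundary_borel_openin openin_Union) blast
  then show ?thesis
    unfolding radial_limit_set_const_nat by (intro sets.countable_INT') auto
qed

text \<open>
  The complement of the support is covered by open null sets, of which countably many suffice by
  the Lindelof property.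
\<close>

lemma AE_boundary_support:
  fixes p :: "'a::{metric_space, second_countable_topology}"
  assumes space: "space M = geometric_boundary" and sets: "sets M = sets (boundary_borel p)"
  shows "AE \<eta> in M. \<eta> \<in> boundary_support p M"
proof -
  obtain C where C: "countable C" "\<forall>V\<in>C. openin (boundary_topology p) V"
    "\<forall>U x. openin (boundary_topology p) U \<and> x \<in> U \<longrightarrow> (\<exists>V\<in>C. x \<in> V \<and> V \<subseteq> U)"
    using second_countable_boundary_topology[of p] unfolding second_countable_def by metis
  have meas: "U \<in> sets M" if "openin (boundary_topology p) U" for U
    using that sets sets_boundary_borel_openin by blast
  define N where "N = (\<Union>V\<in>{V\<in>C. V \<in> null_sets M}. V)"
  have "N \<in> null_sets M"
    unfolding N_def using C(1) by (intro null_sets_UN') auto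
  moreover have "\<eta> \<in> N" if \<eta>: "\<eta> \<in> space M" "\<eta> \<notin> boundary_support p M" for \<eta>
  proof -
    obtain U where U: "openin (boundary_topology p) U" "\<eta> \<in> U" "emeasure M U = 0"
      using \<eta> space by (auto simp: boundary_support_def)
    obtain V where V: "V \<in> C" "\<eta> \<in> V" "V \<subseteq> U"
      using C(3) U(1,2) by blast
    have "V \<in> null_sets M"
      using null_sets_subset[of U M V] V U meas C(2) by (auto simp: null_sets_def)
    then show ?thesis using V by (auto simp: N_def)
  qed
  ultimately show ?thesis
    by (intro AE_I'[of N]) auto
qed

section \<open>The upper shadow estimate\<close>

text \<open>
  If a ray \<open>\<tau>\<close> from \<open>p\<close> is within \<open>c\<close> of \<open>x\<close> at time \<open>t\<close>, then \<open>d(p, \<tau> s) = s\<close> and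
  \<open>d(x, \<tau> s) \<le> c + (s - t)\<close> for \<open>s \<ge> t\<close>, so the differences are at least \<open>t - c\<close>; and
  \<open>t \<ge> d(p, x) - c\<close>.
\<close>

lemma busemann_value_shadow_lower_bound:
  assumes \<eta>: "\<eta> \<in> shadow p (ball x c)" and b: "has_busemann_value \<eta> p x b"
  shows "dist p x - 2 * c \<le> b"
proof -
  obtain \<tau> t where \<tau>: "\<eta> \<in> geometric_boundary" "\<tau> \<in> \<eta>" "\<tau> 0 = p" "t \<ge> 0" "dist x (\<tau> t) < c"
    using \<eta> by (auto simp: shadow_def)
  have ray: "geodesic_ray \<tau>" by (rule boundary_point_geodesic_ray[OF \<tau>(1,2)])
  have "eventually (\<lambda>s. dist p x - 2 * c \<le> dist p (\<tau> s) - dist x (\<tau> s)) at_top"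
  proof (rule eventually_at_top_linorderI[of t])
    fix s assume "t \<le> s"
    then have "dist p (\<tau> s) = s" "dist p (\<tau> t) = t" "dist (\<tau> t) (\<tau> s) = s - t"
      using ray \<tau>(4) by (simp_all add: geodesic_ray_def flip: \<tau>(3))
    then show "dist p x - 2 * c \<le> dist p (\<tau> s) - dist x (\<tau> s)"
      using \<tau>(5) dist_triangle[of x "\<tau> s" "\<tau> t"] dist_triangle[of p x "\<tau> t"]
        dist_commute[of "\<tau> t" x] by argo
  qed
  moreover have "((\<lambda>s. dist p (\<tau> s) - dist x (\<tau> s)) \<longlongrightarrow> b) at_top"
    using b \<tau>(2) by (auto simp: has_busemann_value_def)
  ultimately show ?thesis
    by (intro tendsto_lowerbound) auto
qed

text \<open>
  If \<open>f\<close> is not measurable, \<open>distr\<close> either still is a measure with these values or is the zero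
  measure. This spares the proof that isometries act measurably on the boundary, where the cone
  topologies at \<open>p\<close> and at \<open>\<gamma> p\<close> would have to be compared.
\<close>

lemma emeasure_distr_le:
  "emeasure (distr M N f) A \<le> emeasure M (f -` A \<inter> space M)"
  unfolding distr_def by (simp add: emeasure_measure_of_conv)

lemma shadow_measure_upper_bound:
  fixes p :: "'a::{metric_space, second_countable_topology}"
  assumes cd: "conformal_density p \<Gamma> \<delta> \<mu>" and "\<gamma> \<in> \<Gamma>" "\<delta> \<ge> 0"
  shows "measure (\<mu> p) (shadow p (ball (\<gamma> p) c)) \<le>
    exp (2 * \<delta> * c) * measure (\<mu> p) geometric_boundary * exp (- \<delta> * dist p (\<gamma> p))"
proof -
  define S where "S = shadow p (ball (\<gamma> p) c)"
  define k where "k = exp (\<delta> * (dist p (\<gamma> p) - 2 * c))"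
  interpret finite_measure "\<mu> p" using cd by (auto simp: conformal_density_def)
  have space: "space (\<mu> x) = geometric_boundary"
    and sets: "sets (\<mu> x) = sets (boundary_borel p)" for x
    using cd by (auto simp: conformal_density_def)
  have S: "S \<in> sets (\<mu> p)"
    unfolding S_def sets by (intro sets_boundary_borel_openin openin_shadow open_ball)
  have "\<exists>g\<in>borel_measurable (\<mu> p). \<mu> (\<gamma> p) = density (\<mu> p) g \<and>
      (\<forall>\<eta>\<in>boundary_support p (\<mu> p).
        \<exists>b. has_busemann_value \<eta> p (\<gamma> p) b \<and> g \<eta> = ennreal (exp (\<delta> * b)))"
    by (rule cd[unfolded conformal_density_def, THEN conjunct2, THEN conjunct2, THEN conjunct2,
        THEN conjunct2, THEN spec])
  then obtain g where g: "g \<in> borel_measurable (\<mu> p)" "\<mu> (\<gamma> p) = density (\<mu> p) g"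
    "\<And>\<eta>. \<eta> \<in> boundary_support p (\<mu> p) \<Longrightarrow>
      \<exists>b. has_busemann_value \<eta> p (\<gamma> p) b \<and> g \<eta> = ennreal (exp (\<delta> * b))"
    by blast
  have g_bound: "ennreal k \<le> g \<eta>" if \<eta>: "\<eta> \<in> S" "\<eta> \<in> boundary_support p (\<mu> p)" for \<eta>
  proof -
    obtain b where b: "has_busemann_value \<eta> p (\<gamma> p) b" "g \<eta> = ennreal (exp (\<delta> * b))"
      using g(3)[OF \<eta>(2)] by blast
    have "dist p (\<gamma> p) - 2 * c \<le> b"
      using \<eta>(1) b(1) unfolding S_def by (rule busemann_value_shadow_lower_bound)
    then have "k \<le> exp (\<delta> * b)"
      unfolding k_def using \<open>\<delta> \<ge> 0\<close> by (simp add: mult_left_mono)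
    then show ?thesis using b(2) by (simp add: ennreal_leI)
  qed
  have "ennreal k * emeasure (\<mu> p) S = (\<integral>\<^sup>+\<eta>. ennreal k * indicator S \<eta> \<partial>\<mu> p)"
    using S by (simp add: nn_integral_cmult_indicator)
  also have "\<dots> \<le> (\<integral>\<^sup>+\<eta>. g \<eta> * indicator S \<eta> \<partial>\<mu> p)"
    using AE_boundary_support[OF space sets]
    by (intro nn_integral_mono_AE, eventually_elim) (auto simp: indicator_def g_bound)
  also have "\<dots> = emeasure (\<mu> (\<gamma> p)) S"
    using g(1,2) S by (simp add: emeasure_density)
  also have "\<dots> = emeasure (distr (\<mu> p) (boundary_borel p) (boundary_action \<gamma>)) S"
    using cd \<open>\<gamma> \<in> \<Gamma>\<close> by (auto simp: conformal_density_def)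
  also have "\<dots> \<le> emeasure (\<mu> p) geometric_boundary"
    using emeasure_distr_le emeasure_space order_trans unfolding space[of p, symmetric] by blast
  finally have "ennreal (k * measure (\<mu> p) S) \<le> ennreal (measure (\<mu> p) geometric_boundary)"
    by (simp add: emeasure_eq_measure ennreal_mult k_def)
  then have "k * measure (\<mu> p) S \<le> measure (\<mu> p) geometric_boundary"
    by simp
  moreover have "exp (2 * \<delta> * c) * exp (- \<delta> * dist p (\<gamma> p)) * k = 1"
    unfolding k_def exp_add[symmetric] by (simp add: algebra_simps)
  then have "measure (\<mu> p) S =
      exp (2 * \<delta> * c) * exp (- \<delta> * dist p (\<gamma> p)) * (k * measure (\<mu> p) S)"
    by (metis mult.assoc mult_1)
  ultimately have "measure (\<mu> p) S \<le>
      exp (2 * \<delta> * c) * exp (- \<delta> * dist p (\<gamma> p)) * measure (\<mu> p) geometric_boundary"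
    by (metis exp_ge_zero mult_left_mono mult_nonneg_nonneg)
  then show ?thesis
    unfolding S_def by (simp only: mult_ac)
qed

section \<open>The Borel--Cantelli argument\<close>

text \<open>
  Once an infinite index set is enumerated without repetition, the points that lie in infinitely
  many members of the family form a limit superior.
\<close>

lemma borel_cantelli_countable_family:
  assumes "finite_measure M" "countable I" "\<And>i. i \<in> I \<Longrightarrow> S i \<in> sets M"
    and summable: "(\<lambda>i. measure M (S i)) summable_on I"
  shows "\<exists>N\<in>null_sets M. {x. infinite {i\<in>I. x \<in> S i}} \<subseteq> N"
proof (cases "finite I")
  case True
  then have "{x. infinite {i\<in>I. x \<in> S i}} = {}" by simp
  then show ?thesis by blast
next
  case False
  interpret finite_measure M by fact
  have bij: "bij_betw (from_nat_into I) UNIV I"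
    using assms(2) False by (rule bij_betw_from_nat_into)
  define E where "E n = S (from_nat_into I n)" for n
  have "(\<lambda>n. measure M (E n)) summable_on UNIV"
    unfolding E_def using summable by (subst summable_on_reindex_bij_betw[OF bij])
  then have "summable (\<lambda>n. measure M (E n))"
    by (subst (asm) summable_on_UNIV_nonneg_real_iff) auto
  moreover have "E n \<in> sets M" for n
    unfolding E_def using assms(3) bij by (auto simp: bij_betw_def)
  ultimately have "limsup E \<in> null_sets M"
    by (intro borel_cantelli_limsup1) (auto simp: less_top[symmetric])
  moreover have "x \<in> limsup E" if x: "infinite {i\<in>I. x \<in> S i}" for x
  proof -
    have "{i\<in>I. x \<in> S i} = from_nat_into I ` {n. x \<in> E n}"
      using bij by (auto simp: E_def bij_betw_def)
    then have "infinite {n. x \<in> E n}" using x by auto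
    then show ?thesis
      by (auto simp: limsup_INF_SUP infinite_nat_iff_unbounded_le)
  qed
  ultimately show ?thesis by blast
qed

lemma radial_limit_set_const_infinitely_often:
  assumes "\<xi> \<in> radial_limit_set_const p \<Gamma> c"
  shows "infinite {\<gamma>\<in>\<Gamma>. \<xi> \<in> shadow p (ball (\<gamma> p) c)}"
proof
  assume fin: "finite {\<gamma>\<in>\<Gamma>. \<xi> \<in> shadow p (ball (\<gamma> p) c)}"
  \<comment> \<open>The \<open>1\<close> makes \<open>R\<close> positive, as the radii in the definition are.\<close>
  define R where "R = Max (insert 1 ((\<lambda>\<gamma>. dist p (\<gamma> p)) ` {\<gamma>\<in>\<Gamma>. \<xi> \<in> shadow p (ball (\<gamma> p) c)}))"
  have "R \<ge> 1" unfolding R_def using fin by (intro Max_ge) auto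
  then obtain \<gamma> where \<gamma>: "\<gamma> \<in> \<Gamma>" "dist p (\<gamma> p) > R" "\<xi> \<in> shadow p (ball (\<gamma> p) c)"
    using assms unfolding radial_limit_set_const_def by force
  have "dist p (\<gamma> p) \<le> R" unfolding R_def using fin \<gamma> by (intro Max_ge) auto
  then show False using \<gamma>(2) by simp
qed

theorem lemma5p1:
  fixes A :: "('a::{metric_space, second_countable_topology}, 'n::finite) chart set"
    and G :: "('a, 'n) metric_tensor"
    and \<Gamma> :: "('a \<Rightarrow> 'a) set"
    and h :: "'a \<Rightarrow> 'a"
    and p :: 'a
    and \<delta> :: real
    and \<mu> :: "'a \<Rightarrow> (real \<Rightarrow> 'a) set measure"
  assumes "hadamard_manifold A G"
    and "discrete_isometry_group \<Gamma>"
    and "non_elementary p \<Gamma>"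
    and "h \<in> \<Gamma>" and "rank_one_isometry h"
    and "p \<in> axis_set h"
    and "\<delta> > 0"
    and "conformal_density p \<Gamma> \<delta> \<mu>"
    and "emeasure (\<mu> p) geometric_boundary = 1"
    and "(\<lambda>\<gamma>. exp (- \<delta> * dist p (\<gamma> p))) summable_on \<Gamma>"
  shows "radial_limit_set p \<Gamma> \<in> null_sets (\<mu> p)"
proof -
  have fin: "finite_measure (\<mu> p)" and sets: "sets (\<mu> p) = sets (boundary_borel p)"
    using assms(8) by (auto simp: conformal_density_def)
  \<comment> \<open>A summable family has only countably many nonzero terms.\<close>
  have "countable \<Gamma>"
    using summable_countable_real[OF assms(10)] by simp
  have null: "radial_limit_set_const p \<Gamma> c \<in> null_sets (\<mu> p)" for c
  proof -
    have "(\<lambda>\<gamma>. exp (2 * \<delta> * c) * measure (\<mu> p) geometric_boundary *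
        exp (- \<delta> * dist p (\<gamma> p))) summable_on \<Gamma>"
      using assms(10) by (rule summable_on_cmult_right)
    then have "(\<lambda>\<gamma>. measure (\<mu> p) (shadow p (ball (\<gamma> p) c))) summable_on \<Gamma>"
      using shadow_measure_upper_bound[OF assms(8)] \<open>\<delta> > 0\<close>
      by (elim summable_on_comparison_test) auto
    then obtain N where N: "N \<in> null_sets (\<mu> p)"
      "{\<xi>. infinite {\<gamma>\<in>\<Gamma>. \<xi> \<in> shadow p (ball (\<gamma> p) c)}} \<subseteq> N"
      using borel_cantelli_countable_family[OF fin \<open>countable \<Gamma>\<close>,
          of "\<lambda>\<gamma>. shadow p (ball (\<gamma> p) c)"]
        sets_boundary_borel_openin[OF openin_shadow[OF open_ball]] sets by auto
    have "radial_limit_set_const p \<Gamma> c \<subseteq> N"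
      using N(2) radial_limit_set_const_infinitely_often by blast
    then show ?thesis
      using N(1) sets_radial_limit_set_const sets by (blast intro: null_sets_subset)
  qed
  show ?thesis
    unfolding radial_limit_set_nat by (intro null_sets_UN' null) auto
qed

end
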